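(* Let $F$ be a free filter on $\omega$. Then $N_F$ has the bounded Josefson--Nissenzweig property (BJNP) if and only if there is a sequence $\langle\mu_n: n\in\omega\rangle$ of finitely supported probability measures on $N_F$ such that: (1) $\operatorname{supp}(\mu_n)\subseteq\omega$ for every $n\in\omega$; (2) $\lim_{n\to\infty}\mu_n(A)=1$ for every $A\in F$. Moreover, the equivalence also holds with the additional requirement that the sequence $\langle\mu_n\rangle$ be disjointly supported.
   Context: A filter $F$ on $\omega$ is free if $\bigcap F=\emptyset$ (equivalently, $F$ contains every cofinite subset of $\omega$); filters are proper. For a free filter $F$ on $\omega$, $N_F=\omega\cup\{p_F\}$, where $p_F\notin\omega$ is a fixed point, with the topology in which every point of $\omega$ is isolated and the open neighborhoods of $p_F$ are exactly the sets $A\cup\{p_F\}$ with $A\in F$. A finitely supported measure on a Tychonoff space $X$ is a signed measure $\mu=\sum_{i=1}^n\alpha_i\delta_{x_i}$ with distinct $x_1,\dots,x_n\in X$ and $\alpha_i\in\mathbb{R}\setminus\{0\}$; $\operatorname{supp}(\mu)=\{x_1,\dots,x_n\}$, $\|\mu\|=\sum_i|\alpha_i|$, $\mu(f)=\sum_i\alpha_i f(x_i)$. It is a probability measure if it is non-negative with total mass $1$. A sequence of measures is disjointly supported if the supports are pairwise disjoint. $X$ has the bounded Josefson--Nissenzweig property (BJNP) if there is a sequence $\langle\mu_n: n\in\omega\rangle$ of finitely supported measures on $X$ with $\|\mu_n\|=1$ for all $n$ and $\mu_n(f)\to0$ for every bounded continuous $f:X\to\mathbb{R}$. *)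

theory Defs
  imports "HOL-Analysis.Analysis" "HOL-Library.Poly_Mapping"
begin

subsection \<open>Free filters\<close>

text \<open>The library type of filters also contains the improper filter \<open>bot\<close>, which is excluded here.
  A set \<open>A\<close> belongs to \<open>F\<close> iff \<open>\<forall>\<^sub>F x in F. x \<in> A\<close>.\<close>

definition filter_sets :: "'a filter \<Rightarrow> 'a set set" where
  "filter_sets F = {A. \<forall>\<^sub>F x in F. x \<in> A}"

definition free_filter :: "'a filter \<Rightarrow> bool" where
  "free_filter F \<longleftrightarrow> F \<noteq> bot \<and> \<Inter> (filter_sets F) = {}"

subsection \<open>The space \<open>N\<^sub>F\<close>\<close>

text \<open>The point \<open>n \<in> \<omega>\<close> is \<open>Some n\<close>, the extra point \<open>p\<^sub>F\<close> is \<open>None\<close>.\<close>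

definition NF :: "nat filter \<Rightarrow> nat option topology" where
  "NF F = topology (\<lambda>U. None \<in> U \<longrightarrow> (\<exists>A \<in> filter_sets F. U = Some ` A \<union> {None}))"

lemma NF_nbhd_iff:
  "(\<exists>A \<in> filter_sets F. U = Some ` A \<union> {None}) \<longleftrightarrow>
   None \<in> U \<and> (\<forall>\<^sub>F n in F. Some n \<in> U)"
proof
  assume "None \<in> U \<and> (\<forall>\<^sub>F n in F. Some n \<in> U)"
  moreover have "U = Some ` {n. Some n \<in> U} \<union> {None}" if "None \<in> U"
  proof (rule set_eqI)
    show "x \<in> U \<longleftrightarrow> x \<in> Some ` {n. Some n \<in> U} \<union> {None}" for x
      using that by (cases x) auto
  qed
  ultimately show "\<exists>A \<in> filter_sets F. U = Some ` A \<union> {None}"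
    unfolding filter_sets_def by (intro bexI[of _ "{n. Some n \<in> U}"]) simp_all
qed (auto simp: filter_sets_def elim: eventually_mono)

lemma openin_NF_iff:
  "openin (NF F) U \<longleftrightarrow> (None \<in> U \<longrightarrow> (\<forall>\<^sub>F n in F. Some n \<in> U))"
proof -
  have "istopology (\<lambda>U. None \<in> U \<longrightarrow> (\<forall>\<^sub>F n in F. Some n \<in> U))"
    unfolding istopology_def by (auto simp: eventually_conj_iff elim!: eventually_mono)
  then show ?thesis
    unfolding NF_def NF_nbhd_iff by (simp cong: imp_cong)
qed

lemma openin_NF:
  "openin (NF F) U \<longleftrightarrow> (None \<in> U \<longrightarrow> (\<exists>A \<in> filter_sets F. U = Some ` A \<union> {None}))"
  unfolding openin_NF_iff NF_nbhd_iff by blast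

lemma topspace_NF [simp]: "topspace (NF F) = UNIV"
proof -
  have "openin (NF F) UNIV" by (simp add: openin_NF_iff)
  then show ?thesis using openin_subset by blast
qed

lemma continuous_map_NF_clopen:
  assumes "openin (NF F) U" "closedin (NF F) U"
  shows "continuous_map (NF F) (top_of_set {0..1::real}) (indicator U)"
proof -
  have "openin (NF F) (- U)"
    using assms(2) by (simp add: closedin_def Compl_eq_Diff_UNIV)
  then have "openin (NF F) {x. (indicator U x :: real) \<in> V}" for V
    using assms(1) by (cases "(0::real) \<in> V"; cases "(1::real) \<in> V")
      (auto simp: indicator_def if_distrib Compl_eq openin_NF_iff cong: if_cong)
  then show ?thesis
    by (auto simp: continuous_map_in_subtopology continuous_map_def indicator_def)
qed

lemma Hausdorff_space_NF:
  assumes "free_filter F" shows "Hausdorff_space (NF F)"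
proof -
  have ev: "\<forall>\<^sub>F n in F. n \<noteq> m" for m
  proof -
    obtain A where "A \<in> filter_sets F" "m \<notin> A"
      using assms by (auto simp: free_filter_def)
    then show ?thesis by (auto simp: filter_sets_def elim: eventually_mono)
  qed
  show ?thesis
    unfolding Hausdorff_space_def
  proof (intro allI impI)
    fix x y assume "x \<in> topspace (NF F) \<and> y \<in> topspace (NF F) \<and> x \<noteq> y"
    then consider n m where "x = Some n" "y = Some m" "n \<noteq> m"
      | n where "x = Some n" "y = None" | n where "x = None" "y = Some n"
      by (metis not_Some_eq)
    then show "\<exists>U V. openin (NF F) U \<and> openin (NF F) V \<and> x \<in> U \<and> y \<in> V \<and> disjnt U V"
    proof cases
      case (1 n m)
      then show ?thesis
        by (intro exI[of _ "{Some n}"] exI[of _ "{Some m}"]) (auto simp: openin_NF_iff)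
    next
      case (2 n)
      then show ?thesis using ev[of n]
        by (intro exI[of _ "{Some n}"] exI[of _ "- {Some n}"]) (auto simp: openin_NF_iff disjnt_def)
    next
      case (3 n)
      then show ?thesis using ev[of n]
        by (intro exI[of _ "- {Some n}"] exI[of _ "{Some n}"]) (auto simp: openin_NF_iff disjnt_def)
    qed
  qed
qed

lemma completely_regular_space_NF:
  assumes "free_filter F" shows "completely_regular_space (NF F)"
  unfolding completely_regular_space_def
proof (intro allI impI)
  fix S x assume *: "closedin (NF F) S \<and> x \<in> topspace (NF F) - S"
  define U where "U = (if x = None then S else - {x})"
  have cl: "closedin (NF F) {x}"
    using Hausdorff_space_NF[OF assms] by (simp add: closedin_Hausdorff_singleton)
  have "openin (NF F) U \<and> closedin (NF F) U"
  proof (cases "x = None")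
    case True
    then show ?thesis using * by (auto simp: U_def openin_NF_iff)
  next
    case False
    then show ?thesis using cl
      by (auto simp: U_def openin_NF_iff closedin_def Compl_eq_Diff_UNIV[symmetric])
  qed
  moreover have "S \<subseteq> U" "x \<notin> U" using * by (auto simp: U_def)
  ultimately show "\<exists>f. continuous_map (NF F) (top_of_set {0..1::real}) f \<and> f x = 0 \<and> f ` S \<subseteq> {1}"
    by (intro exI[of _ "indicator U"]) (auto intro: continuous_map_NF_clopen)
qed

subsection \<open>Finitely supported signed measures\<close>

text \<open>A finite combination of point masses \<open>\<Sum>\<^sub>i \<alpha>\<^sub>i \<delta>\<^bsub>x\<^sub>i\<^esub>\<close> with distinct \<open>x\<^sub>i\<close> and nonzero real \<open>\<alpha>\<^sub>i\<close>
  is encoded by the finitely supported map \<open>x\<^sub>i \<mapsto> \<alpha>\<^sub>i\<close>.  (The norm is written out rather than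
  taken from a type-class instance on \<open>\<Rightarrow>\<^sub>0\<close>.)\<close>

type_synonym 'a fs_measure = "'a \<Rightarrow>\<^sub>0 real"

abbreviation supp :: "'a fs_measure \<Rightarrow> 'a set" where
  "supp \<mu> \<equiv> Poly_Mapping.keys \<mu>"

definition fs_measure_on :: "'a topology \<Rightarrow> 'a fs_measure \<Rightarrow> bool" where
  "fs_measure_on X \<mu> \<longleftrightarrow> supp \<mu> \<subseteq> topspace X"

definition fs_norm :: "'a fs_measure \<Rightarrow> real" where
  "fs_norm \<mu> = (\<Sum>x \<in> supp \<mu>. \<bar>Poly_Mapping.lookup \<mu> x\<bar>)"

definition fs_integral :: "'a fs_measure \<Rightarrow> ('a \<Rightarrow> real) \<Rightarrow> real" where
  "fs_integral \<mu> f = (\<Sum>x \<in> supp \<mu>. Poly_Mapping.lookup \<mu> x * f x)"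

definition fs_mass :: "'a fs_measure \<Rightarrow> 'a set \<Rightarrow> real" where
  "fs_mass \<mu> A = (\<Sum>x \<in> supp \<mu> \<inter> A. Poly_Mapping.lookup \<mu> x)"

definition fs_prob_measure_on :: "'a topology \<Rightarrow> 'a fs_measure \<Rightarrow> bool" where
  "fs_prob_measure_on X \<mu> \<longleftrightarrow>
     fs_measure_on X \<mu> \<and> (\<forall>A \<subseteq> topspace X. 0 \<le> fs_mass \<mu> A) \<and> fs_mass \<mu> (topspace X) = 1"

definition disjointly_supported :: "(nat \<Rightarrow> 'a fs_measure) \<Rightarrow> bool" where
  "disjointly_supported \<mu> \<longleftrightarrow> disjoint_family (\<lambda>n. supp (\<mu> n))"

subsection \<open>The bounded Josefson--Nissenzweig property\<close>

text \<open>The property is meant for Tychonoff spaces; by \<open>completely_regular_space_NF\<close> and \<open>Hausdorff_space_NF\<close> the spaces \<open>NF F\<close> are such.\<close>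

definition BJNP :: "'a topology \<Rightarrow> bool" where
  "BJNP X \<longleftrightarrow>
     (\<exists>\<mu> :: nat \<Rightarrow> 'a fs_measure.
        (\<forall>n. fs_measure_on X (\<mu> n) \<and> fs_norm (\<mu> n) = 1) \<and>
        (\<forall>f :: 'a \<Rightarrow> real. continuous_map X euclideanreal f \<and> bounded (f ` topspace X) \<longrightarrow>
           (\<lambda>n. fs_integral (\<mu> n) f) \<longlonglongrightarrow> 0))"

end

theory Submission
  imports Defs
begin

text \<open>If \<open>\<mu>\<^sub>n\<close> are probability measures as in the theorem, then \<open>(\<delta>\<^sub>p - \<mu>\<^sub>n) / 2\<close> witnesses the BJNP.
  Conversely, let \<open>\<nu>\<^sub>n\<close> witness the BJNP.  For \<open>A \<in> F\<close> every bounded function vanishing on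
  \<open>A \<union> {p}\<close> is continuous, so a gliding hump argument (the Schur property of \<open>\<ell>\<^sub>1\<close>) gives
  \<open>\<bar>\<nu>\<^sub>n\<bar>(\<omega> - A) \<longlonglongrightarrow> 0\<close>.  Since \<open>\<nu>\<^sub>n(1) \<longlonglongrightarrow> 0\<close>, the point \<open>p\<close> carries asymptotically at
  most half of \<open>\<bar>\<nu>\<^sub>n\<bar>\<close>, and finite sets are asymptotically negligible in \<open>\<omega>\<close>.  Hence one can choose
  a subsequence whose terms, restricted to \<open>\<omega>\<close> minus the previous supports, have variation bounded
  away from \<open>0\<close>; the normalised variations of these restrictions are the required measures.\<close>

section \<open>Gliding hump and the Schur property\<close>

text \<open>Before step \<open>k\<close> only finitely many finite supports have been used, so their
  union is a legitimate \<open>T\<close>. The argument \<open>k\<close> of \<open>R\<close> allows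
  the chosen indices to be forced upwards.\<close>

lemma choice_avoiding_previous:
  fixes S :: "'b \<Rightarrow> 'a set"
  assumes "\<And>n. finite (S n)" and "\<And>T k. finite T \<Longrightarrow> \<exists>n. R T k n"
  obtains r :: "nat \<Rightarrow> 'b" where "\<And>k. R (\<Union>j<k. S (r j)) k (r k)"
proof -
  have "\<exists>r. \<forall>k::nat. R (\<Union>j<k. S (r j)) k (r k)"
    by (rule dependent_wellorder_choice) (auto simp: assms)
  then show thesis using that by blast
qed

text \<open>If the sums stayed at least \<open>e\<close> along a subsequence, one could pick rows
  whose mass lies mostly off the supports picked before. A single sign function then tests all these
  rows to more than \<open>e / 2\<close>.\<close>

lemma finite_support_Schur:
  fixes c :: "nat \<Rightarrow> 'a \<Rightarrow> real"
  assumes fin: "\<And>n. finite (S n)"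
    and null: "\<And>f. (\<And>x. \<bar>f x\<bar> \<le> 1) \<Longrightarrow> (\<lambda>n. \<Sum>x\<in>S n. c n x * f x) \<longlonglongrightarrow> 0"
  shows "(\<lambda>n. \<Sum>x\<in>S n. \<bar>c n x\<bar>) \<longlonglongrightarrow> 0"
proof (rule ccontr)
  assume "\<not> ?thesis"
  then obtain e where e: "e > 0" and large: "\<And>N. \<exists>n\<ge>N. (\<Sum>x\<in>S n. \<bar>c n x\<bar>) \<ge> e"
    unfolding lim_sequentially dist_real_def
    by (auto simp: not_less sum_nonneg abs_of_nonneg)
  have point: "(\<lambda>n. if x \<in> S n then c n x else 0) \<longlonglongrightarrow> 0" for x
  proof -
    have "(\<Sum>y\<in>S n. c n y * indicator {x} y) = (if x \<in> S n then c n x else 0)" for n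
      using fin[of n] by (simp add: indicator_def of_bool_def if_distrib sum.delta cong: if_cong)
    then show ?thesis
      using null[of "indicator {x}"] by simp
  qed
  have small: "(\<lambda>n. \<Sum>x\<in>S n \<inter> T. \<bar>c n x\<bar>) \<longlonglongrightarrow> 0" if "finite T" for T
  proof -
    have "(\<lambda>n. \<Sum>x\<in>T. \<bar>if x \<in> S n then c n x else 0\<bar>) \<longlonglongrightarrow> (\<Sum>x\<in>T. 0)"
      by (intro tendsto_sum tendsto_rabs_zero point)
    moreover have "(\<Sum>x\<in>T. \<bar>if x \<in> S n then c n x else 0\<bar>) = (\<Sum>x\<in>S n \<inter> T. \<bar>c n x\<bar>)" for n
      using that by (subst Int_commute) (auto simp: sum.inter_restrict intro!: sum.cong)
    ultimately show ?thesis by simp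
  qed
  \<comment> \<open>With at most \<open>e / 4\<close> on the old points, more than
    \<open>3 * e / 4\<close> lies on new ones; even if the old points contribute with the wrong
    sign, more than \<open>e / 2\<close> remains.\<close>
  define R where "R = (\<lambda>T k n. k \<le> n \<and> (\<Sum>x\<in>S n. \<bar>c n x\<bar>) \<ge> e \<and> (\<Sum>x\<in>S n \<inter> T. \<bar>c n x\<bar>) < e / 4)"
  have "\<exists>n. R T k n" if T: "finite T" for T k
  proof -
    have "\<forall>\<^sub>F n in sequentially. (\<Sum>x\<in>S n \<inter> T. \<bar>c n x\<bar>) < e / 4"
      using order_tendstoD(2)[OF small[OF T], of "e / 4"] e by simp
    then obtain N where "\<And>n. n \<ge> N \<Longrightarrow> (\<Sum>x\<in>S n \<inter> T. \<bar>c n x\<bar>) < e / 4"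
      by (auto simp: eventually_sequentially)
    then show ?thesis
      using large[of "max N k"] by (auto simp: R_def)
  qed
  from choice_avoiding_previous[of S R, OF fin this]
  obtain r where r: "\<And>k. R (\<Union>j<k. S (r j)) k (r k)" by blast
  \<comment> \<open>Each point takes its sign from the first chosen row whose support contains it,
    so later rows cannot disturb the value. Off all chosen supports \<open>LEAST\<close> is
    arbitrary, but \<open>f\<close> remains bounded by 1.\<close>
  define f where "f x = sgn (c (r (LEAST k. x \<in> S (r k))) x)" for x
  have "(\<lambda>n. \<Sum>x\<in>S n. c n x * f x) \<longlonglongrightarrow> 0"
    by (rule null) (simp add: f_def abs_sgn_eq)
  then have "\<forall>\<^sub>F n in sequentially. (\<Sum>x\<in>S n. c n x * f x) < e / 2"
    using order_tendstoD(2)[of _ 0 sequentially "e / 2"] e by simp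
  then obtain N where N: "\<And>n. n \<ge> N \<Longrightarrow> (\<Sum>x\<in>S n. c n x * f x) < e / 2"
    by (auto simp: eventually_sequentially)
  define T where "T = (\<Union>j<N. S (r j))"
  \<comment> \<open>As \<open>N \<le> r N\<close>, the bound obtained for indices from
    \<open>N\<close> on applies to the row \<open>r N\<close>.\<close>
  let ?n = "r N"
  have RN: "N \<le> ?n" "(\<Sum>x\<in>S ?n. \<bar>c ?n x\<bar>) \<ge> e" "(\<Sum>x\<in>S ?n \<inter> T. \<bar>c ?n x\<bar>) < e / 4"
    using r[of N] by (auto simp: R_def T_def)
  have new: "c ?n x * f x = \<bar>c ?n x\<bar>" if "x \<in> S ?n - T" for x
  proof -
    have "(LEAST k. x \<in> S (r k)) = N"
      using that by (intro Least_equality) (auto simp: T_def not_less[symmetric])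
    then show ?thesis by (simp add: f_def abs_sgn)
  qed
  have old: "c ?n x * f x \<ge> - \<bar>c ?n x\<bar>" for x
    by (simp add: f_def sgn_real_def abs_if)
  have split: "(\<Sum>x\<in>S ?n. g x) = (\<Sum>x\<in>S ?n \<inter> T. g x) + (\<Sum>x\<in>S ?n - T. g x)" for g :: "'a \<Rightarrow> real"
    using sum.Int_Diff[OF fin] .
  have "(\<Sum>x\<in>S ?n \<inter> T. c ?n x * f x) \<ge> - (\<Sum>x\<in>S ?n \<inter> T. \<bar>c ?n x\<bar>)"
    unfolding sum_negf[symmetric] by (intro sum_mono old)
  moreover have "(\<Sum>x\<in>S ?n - T. c ?n x * f x) = (\<Sum>x\<in>S ?n - T. \<bar>c ?n x\<bar>)"
    by (intro sum.cong refl new)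
  ultimately show False
    using N[OF RN(1)] RN(2,3) split[of "\<lambda>x. c ?n x * f x"] split[of "\<lambda>x. \<bar>c ?n x\<bar>"] by linarith
qed

section \<open>Continuity in \<open>NF F\<close> and finite sets\<close>

text \<open>Points of the form \<open>Some n\<close> are isolated, so only the preimages of
  neighbourhoods of \<open>f None\<close> impose a condition.\<close>

lemma continuous_map_NF_iff:
  fixes f :: "nat option \<Rightarrow> 'a::topological_space"
  shows "continuous_map (NF F) euclidean f \<longleftrightarrow> ((\<lambda>n. f (Some n)) \<longlongrightarrow> f None) F"
  by (auto simp: continuous_map_def openin_NF_iff tendsto_def)

lemma free_filter_avoids_finite:
  assumes "free_filter F" "finite T"
  shows "\<forall>\<^sub>F n in F. n \<notin> T"
proof -
  have "\<forall>\<^sub>F n in F. n \<noteq> m" for m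
  proof -
    obtain A where "A \<in> filter_sets F" "m \<notin> A"
      using assms(1) by (auto simp: free_filter_def)
    then show ?thesis by (auto simp: filter_sets_def elim: eventually_mono)
  qed
  then have "\<forall>\<^sub>F n in F. \<forall>m\<in>T. n \<noteq> m"
    using assms(2) by (intro eventually_ball_finite) auto
  then show ?thesis by (auto elim: eventually_mono)
qed

section \<open>Normalised weights as probability measures\<close>

text \<open>The conditional distribution of the weight \<open>w\<close> on \<open>S\<close>;
  meaningful for finite \<open>S\<close> with \<open>sum w S\<close> nonzero, while a zero total
  yields the zero measure.\<close>

definition fs_normalize :: "('a \<Rightarrow> real) \<Rightarrow> 'a set \<Rightarrow> 'a fs_measure" where
  "fs_normalize w S = Abs_poly_mapping (\<lambda>x. if x \<in> S then w x / sum w S else 0)"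

lemma lookup_fs_normalize:
  assumes "finite S"
  shows "Poly_Mapping.lookup (fs_normalize w S) x = (if x \<in> S then w x / sum w S else 0)"
proof -
  have "finite {x. (if x \<in> S then w x / sum w S else 0) \<noteq> 0}"
    by (rule finite_subset[OF _ assms]) auto
  then show ?thesis by (simp add: fs_normalize_def)
qed

lemma supp_fs_normalize: "finite S \<Longrightarrow> supp (fs_normalize w S) \<subseteq> S"
  by (auto simp: in_keys_iff lookup_fs_normalize split: if_splits)

lemma fs_mass_fs_normalize:
  assumes "finite S"
  shows "fs_mass (fs_normalize w S) A = sum w (S \<inter> A) / sum w S"
proof -
  have "fs_mass (fs_normalize w S) A = (\<Sum>x\<in>S \<inter> A. Poly_Mapping.lookup (fs_normalize w S) x)"
    unfolding fs_mass_def
    using supp_fs_normalize[OF assms, of w] assms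
    by (intro sum.mono_neutral_left) (auto simp: in_keys_iff)
  then show ?thesis
    by (simp add: lookup_fs_normalize assms sum_divide_distrib)
qed

lemma fs_prob_measure_on_fs_normalize:
  assumes "finite S" "S \<subseteq> topspace X" "\<And>x. 0 \<le> w x" "0 < sum w S"
  shows "fs_prob_measure_on X (fs_normalize w S)"
  using assms supp_fs_normalize[OF assms(1), of w]
  by (auto simp: fs_prob_measure_on_def fs_measure_on_def fs_mass_fs_normalize sum_nonneg Int_absorb2)

section \<open>From the BJNP to disjointly supported probability measures\<close>

lemma BJNP_NF_imp_disjoint_prob:
  assumes F: "free_filter F" and "BJNP (NF F)"
  obtains \<mu> :: "nat \<Rightarrow> nat option fs_measure" where
    "\<And>n. fs_prob_measure_on (NF F) (\<mu> n)" "\<And>n. supp (\<mu> n) \<subseteq> range Some"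
    "\<And>A. A \<in> filter_sets F \<Longrightarrow> (\<lambda>n. fs_mass (\<mu> n) (Some ` A)) \<longlonglongrightarrow> 1"
    "disjointly_supported \<mu>"
proof -
  obtain \<nu> :: "nat \<Rightarrow> nat option fs_measure" where norm: "\<And>n. fs_norm (\<nu> n) = 1"
    and null: "\<And>f. continuous_map (NF F) euclideanreal f \<Longrightarrow> bounded (range f) \<Longrightarrow>
      (\<lambda>n. fs_integral (\<nu> n) f) \<longlonglongrightarrow> 0"
    using assms(2) unfolding BJNP_def topspace_NF by blast
  define w where "w n x = \<bar>Poly_Mapping.lookup (\<nu> n) x\<bar>" for n x
  have w: "0 \<le> w n x" for n x by (simp add: w_def)
  \<comment> \<open>Such \<open>B\<close> are the subsets of \<omega> in the ideal dual to
    \<open>F\<close>.\<close>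
  have ideal: "(\<lambda>n. sum (w n) (supp (\<nu> n) \<inter> B)) \<longlonglongrightarrow> 0"
    if B: "\<forall>\<^sub>F n in F. Some n \<notin> B" "None \<notin> B" for B
    unfolding w_def
  proof (rule finite_support_Schur)
    fix f :: "nat option \<Rightarrow> real" assume f: "\<And>x. \<bar>f x\<bar> \<le> 1"
    \<comment> \<open>Cutting \<open>f\<close> off outside \<open>B\<close> makes it eventually zero
      along \<open>F\<close> and zero at \<open>None\<close>, hence continuous.\<close>
    define g where "g x = (if x \<in> B then f x else 0)" for x
    have "((\<lambda>n. g (Some n)) \<longlongrightarrow> 0) F"
      using B(1) by (intro tendsto_eventually) (auto simp: g_def elim: eventually_mono)
    then have "continuous_map (NF F) euclideanreal g"
      using B(2) by (simp add: continuous_map_NF_iff g_def)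
    moreover have "bounded (range g)"
      using f by (auto simp: bounded_iff g_def intro!: exI[of _ 1])
    ultimately have "(\<lambda>n. fs_integral (\<nu> n) g) \<longlonglongrightarrow> 0" by (rule null)
    moreover have "fs_integral (\<nu> n) g = (\<Sum>x\<in>supp (\<nu> n) \<inter> B. Poly_Mapping.lookup (\<nu> n) x * f x)" for n
      by (auto simp: fs_integral_def g_def sum.inter_restrict intro!: sum.cong)
    ultimately show "(\<lambda>n. \<Sum>x\<in>supp (\<nu> n) \<inter> B. Poly_Mapping.lookup (\<nu> n) x * f x) \<longlonglongrightarrow> 0"
      by simp
  qed simp
  \<comment> \<open>If \<open>a\<close> is the variation on \<omega>, then \<open>None\<close>
    carries \<open>1 - a\<close>. A total charge below \<open>1 / 3\<close> in absolute value forces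
    \<open>1 - a < a + 1 / 3\<close>, that is \<open>a > 1 / 3\<close>.\<close>
  have third: "\<forall>\<^sub>F n in sequentially. sum (w n) (supp (\<nu> n) \<inter> range Some) > 1 / 3"
  proof -
    have "(\<lambda>n. fs_integral (\<nu> n) (\<lambda>_. 1)) \<longlonglongrightarrow> 0"
      by (rule null) (auto simp: bounded_iff)
    then have "\<forall>\<^sub>F n in sequentially. \<bar>fs_integral (\<nu> n) (\<lambda>_. 1)\<bar> < 1 / 3"
      using order_tendstoD(2)[OF tendsto_rabs_zero, of _ sequentially "1 / 3"] by simp
    then show ?thesis
    proof (rule eventually_mono)
      fix n assume n: "\<bar>fs_integral (\<nu> n) (\<lambda>_. 1)\<bar> < 1 / 3"
      \<comment> \<open>Since \<open>g\<close> vanishes off the support, adding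
        \<open>g None\<close> is correct whether or not \<open>None\<close> belongs to the
        support.\<close>
      have split: "(\<Sum>x\<in>supp (\<nu> n). g x) = (\<Sum>x\<in>supp (\<nu> n) \<inter> range Some. g x) + g None"
        if "\<And>x. x \<notin> supp (\<nu> n) \<Longrightarrow> g x = 0" for g :: "nat option \<Rightarrow> real"
      proof -
        have "supp (\<nu> n) - range Some \<subseteq> {None}" by (auto simp: notin_range_Some)
        then have "(\<Sum>x\<in>supp (\<nu> n) - range Some. g x) = (\<Sum>x\<in>{None}. g x)"
          by (intro sum.mono_neutral_left) (auto simp: that)
        then show ?thesis by (simp add: sum.Int_Diff[of "supp (\<nu> n)" g "range Some"])
      qed
      have "sum (w n) (supp (\<nu> n) \<inter> range Some) + w n None = 1"
        using norm[of n] by (subst split[symmetric]) (auto simp: fs_norm_def w_def in_keys_iff)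
      moreover have "(\<Sum>x\<in>supp (\<nu> n) \<inter> range Some. Poly_Mapping.lookup (\<nu> n) x)
          + Poly_Mapping.lookup (\<nu> n) None = fs_integral (\<nu> n) (\<lambda>_. 1)"
        by (subst split[symmetric]) (auto simp: fs_integral_def in_keys_iff)
      moreover have "\<bar>\<Sum>x\<in>supp (\<nu> n) \<inter> range Some. Poly_Mapping.lookup (\<nu> n) x\<bar>
          \<le> sum (w n) (supp (\<nu> n) \<inter> range Some)"
        unfolding w_def by (rule sum_abs)
      ultimately show "sum (w n) (supp (\<nu> n) \<inter> range Some) > 1 / 3"
        using n unfolding w_def by linarith
    qed
  qed
  \<comment> \<open>Of the \<open>1 / 3\<close> carried by \<omega>, the finite set \<open>T\<close>
    eventually takes less than \<open>1 / 6\<close>, because freeness puts its trace on \<omega>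
    into the dual ideal.\<close>
  define R where "R = (\<lambda>T k n. k \<le> n \<and> sum (w n) (supp (\<nu> n) \<inter> range Some - T) > 1 / 6)"
  have "\<exists>n. R T k n" if T: "finite T" for T k
  proof -
    have "finite {n. Some n \<in> T}"
      using finite_vimageI[OF T, of Some] by (simp add: vimage_def)
    then have "\<forall>\<^sub>F n in F. Some n \<notin> range Some \<inter> T"
      using free_filter_avoids_finite[OF F] by fastforce
    from order_tendstoD(2)[OF ideal[OF this], of "1 / 6"]
    have "\<forall>\<^sub>F n in sequentially. sum (w n) (supp (\<nu> n) \<inter> range Some \<inter> T) < 1 / 6"
      by (simp add: Int_assoc)
    with third eventually_ge_at_top[of k]
    have "\<forall>\<^sub>F n in sequentially. R T k n"
    proof eventually_elim
      case (elim n)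
      have "sum (w n) (supp (\<nu> n) \<inter> range Some) =
        sum (w n) (supp (\<nu> n) \<inter> range Some \<inter> T) + sum (w n) (supp (\<nu> n) \<inter> range Some - T)"
        by (rule sum.Int_Diff) simp
      with elim show ?case by (simp add: R_def)
    qed
    then show ?thesis by (auto simp: eventually_sequentially)
  qed
  from choice_avoiding_previous[of "\<lambda>n. supp (\<nu> n)" R, OF finite_keys this]
  obtain r where r: "\<And>k. R (\<Union>j<k. supp (\<nu> (r j))) k (r k)" by blast
  \<comment> \<open>Removing all earlier supports, not just the earlier \<open>S j\<close>, matches
    the set avoided in the choice of \<open>r\<close> and makes the \<open>S k\<close>
    disjoint.\<close>
  define S where "S k = supp (\<nu> (r k)) \<inter> range Some - (\<Union>j<k. supp (\<nu> (r j)))" for k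
  define \<mu> where "\<mu> k = fs_normalize (w (r k)) (S k)" for k
  have fin: "finite (S k)" for k by (simp add: S_def)
  have rk: "k \<le> r k" and sixth: "sum (w (r k)) (S k) > 1 / 6" for k
    using r[of k] by (auto simp: R_def S_def)
  have pos: "sum (w (r k)) (S k) > 0" for k using sixth[of k] by linarith
  have supp: "supp (\<mu> k) \<subseteq> S k" for k
    unfolding \<mu>_def by (rule supp_fs_normalize[OF fin])
  show thesis
  proof
    show "fs_prob_measure_on (NF F) (\<mu> n)" for n
      unfolding \<mu>_def using pos by (intro fs_prob_measure_on_fs_normalize fin w) auto
    show "supp (\<mu> n) \<subseteq> range Some" for n
      using supp[of n] by (auto simp: S_def)
    have "S i \<inter> S j = {}" if "i < j" for i j using that by (auto simp: S_def)
    then have "S i \<inter> S j = {}" if "i \<noteq> j" for i j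
      using that by (metis Int_commute linorder_neqE_nat)
    with supp show "disjointly_supported \<mu>"
      unfolding disjointly_supported_def disjoint_family_on_def by blast
  next
    fix A assume "A \<in> filter_sets F"
    then have "\<forall>\<^sub>F n in F. Some n \<notin> range Some - Some ` A"
      by (auto simp: filter_sets_def elim: eventually_mono)
    from ideal[OF this]
    have "(\<lambda>n. sum (w n) (supp (\<nu> n) \<inter> (range Some - Some ` A))) \<longlonglongrightarrow> 0" (is "?d \<longlonglongrightarrow> 0") by simp
    moreover have "filterlim r at_top sequentially"
      by (rule filterlim_at_top_mono[OF filterlim_ident]) (simp add: rk)
    ultimately have "(\<lambda>k. ?d (r k)) \<longlonglongrightarrow> 0" by (rule filterlim_compose)
    \<comment> \<open>The factor 6 comes from the normalising totals exceeding \<open>1 / 6\<close>: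
      the mass lost off \<open>A\<close> is at most six times the variation there.\<close>
    then have "(\<lambda>k. 1 - 6 * ?d (r k)) \<longlonglongrightarrow> 1 - 6 * 0"
      by (intro tendsto_intros)
    then have lower: "(\<lambda>k. 1 - 6 * ?d (r k)) \<longlonglongrightarrow> 1" by simp
    have mass: "fs_mass (\<mu> k) (Some ` A) = 1 - sum (w (r k)) (S k - Some ` A) / sum (w (r k)) (S k)" for k
      using pos[of k] sum.Int_Diff[OF fin, of "w (r k)" k "Some ` A"]
      by (simp add: \<mu>_def fs_mass_fs_normalize fin field_simps)
    have "1 - 6 * ?d (r k) \<le> fs_mass (\<mu> k) (Some ` A)" for k
    proof -
      have "sum (w (r k)) (S k - Some ` A) / sum (w (r k)) (S k)
          \<le> sum (w (r k)) (S k - Some ` A) / (1 / 6)"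
        using sixth[of k] by (intro divide_left_mono) (auto intro!: sum_nonneg w mult_pos_pos pos)
      moreover have "sum (w (r k)) (S k - Some ` A) \<le> ?d (r k)"
        by (intro sum_mono2) (auto simp: S_def w)
      ultimately show ?thesis by (simp add: mass)
    qed
    moreover have "fs_mass (\<mu> k) (Some ` A) \<le> 1" for k
      using pos[of k] by (simp add: mass sum_nonneg w)
    ultimately show "(\<lambda>k. fs_mass (\<mu> k) (Some ` A)) \<longlonglongrightarrow> 1"
      by (intro tendsto_sandwich[OF _ _ lower tendsto_const]) auto
  qed
qed

section \<open>From probability measures to the BJNP\<close>

text \<open>A bounded continuous \<open>f\<close> is close to \<open>f None\<close> on a set of
  \<open>F\<close>, where the \<open>\<mu> n\<close> concentrate, so the integrals of
  \<open>f\<close> against \<open>\<mu> n\<close> tend to \<open>f None\<close>, its integral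
  against the point mass at \<open>None\<close>.\<close>

lemma prob_imp_BJNP_NF:
  fixes \<mu> :: "nat \<Rightarrow> nat option fs_measure"
  assumes prob: "\<And>n. fs_prob_measure_on (NF F) (\<mu> n)"
    and supp: "\<And>n. supp (\<mu> n) \<subseteq> range Some"
    and lim: "\<And>A. A \<in> filter_sets F \<Longrightarrow> (\<lambda>n. fs_mass (\<mu> n) (Some ` A)) \<longlonglongrightarrow> 1"
  shows "BJNP (NF F)"
proof -
  let ?m = "\<lambda>n. Poly_Mapping.lookup (\<mu> n)"
  have nonneg: "0 \<le> ?m n x" for n x
  proof (cases "x \<in> supp (\<mu> n)")
    case True
    moreover have "0 \<le> fs_mass (\<mu> n) {x}"
      using prob[of n] by (simp add: fs_prob_measure_on_def)
    ultimately show ?thesis by (simp add: fs_mass_def)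
  qed (simp add: in_keys_iff)
  have total: "(\<Sum>x\<in>supp (\<mu> n). ?m n x) = 1" for n
    using prob[of n] by (simp add: fs_prob_measure_on_def fs_mass_def)
  have None: "None \<notin> supp (\<mu> n)" for n using supp[of n] by auto
  define \<nu> :: "nat \<Rightarrow> nat option fs_measure"
    where "\<nu> n = Abs_poly_mapping (\<lambda>x. if x = None then 1 / 2 else - ?m n x / 2)" for n
  have lookup: "Poly_Mapping.lookup (\<nu> n) x = (if x = None then 1 / 2 else - ?m n x / 2)" for n x
  proof -
    have "finite {x. (if x = None then 1 / 2 else - ?m n x / 2) \<noteq> 0}"
      by (rule finite_subset[of _ "insert None (supp (\<mu> n))"]) (auto simp: in_keys_iff)
    then show ?thesis by (simp add: \<nu>_def)
  qed
  have keys: "supp (\<nu> n) = insert None (supp (\<mu> n))" for n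
    by (auto simp: in_keys_iff lookup split: if_splits)
  have norm: "fs_norm (\<nu> n) = 1" for n
  proof -
    have "(\<Sum>x\<in>supp (\<mu> n). \<bar>Poly_Mapping.lookup (\<nu> n) x\<bar>) = (\<Sum>x\<in>supp (\<mu> n). ?m n x / 2)"
      using None[of n] nonneg by (intro sum.cong) (auto simp: lookup)
    then show ?thesis
      using None[of n] total[of n] by (simp add: fs_norm_def keys lookup sum_divide_distrib[symmetric])
  qed
  have integral: "fs_integral (\<nu> n) f = (\<Sum>x\<in>supp (\<mu> n). ?m n x * (f None - f x)) / 2" for n f
  proof -
    have "(\<Sum>x\<in>supp (\<mu> n). Poly_Mapping.lookup (\<nu> n) x * f x) = (\<Sum>x\<in>supp (\<mu> n). - (?m n x * f x) / 2)"
      using None[of n] by (intro sum.cong) (auto simp: lookup)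
    then have "fs_integral (\<nu> n) f = (f None - (\<Sum>x\<in>supp (\<mu> n). ?m n x * f x)) / 2"
      using None[of n]
      by (simp add: fs_integral_def keys lookup sum_negf sum_divide_distrib[symmetric] diff_divide_distrib)
    \<comment> \<open>Total mass 1 turns the constant into an average, so that the integral becomes
      an average of differences.\<close>
    also have "f None = (\<Sum>x\<in>supp (\<mu> n). ?m n x * f None)"
      by (simp add: sum_distrib_right[symmetric] total)
    finally show ?thesis by (simp add: sum_subtractf right_diff_distrib)
  qed
  have "(\<lambda>n. fs_integral (\<nu> n) f) \<longlonglongrightarrow> 0"
    if cont: "continuous_map (NF F) euclideanreal f" and bdd: "bounded (range f)" for f
  proof (rule LIMSEQ_I)
    fix e :: real assume e: "e > 0"
    obtain M where M: "\<And>x. \<bar>f x\<bar> \<le> M" and "M > 0"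
      using bdd unfolding bounded_pos by auto
    define A where "A = {n. \<bar>f None - f (Some n)\<bar> < e}"
    have "\<forall>\<^sub>F n in F. dist (f (Some n)) (f None) < e"
      using cont e by (intro tendstoD) (simp add: continuous_map_NF_iff)
    then have "A \<in> filter_sets F"
      by (simp add: A_def filter_sets_def dist_real_def abs_minus_commute)
    \<comment> \<open>Off \<open>A\<close> the differences are at most \<open>2 * M\<close>, so a
      remaining mass below \<open>e / (2 * M)\<close> contributes less than \<open>e\<close>. With
      at most \<open>e\<close> from \<open>A\<close>, the sum is below \<open>2 * e\<close>, and the
      factor \<open>1 / 2\<close> in \<open>\<nu> n\<close> restores \<open>e\<close>.\<close>
    from order_tendstoD(1)[OF lim[OF this], of "1 - e / (2 * M)"]
    obtain N where N: "\<And>n. n \<ge> N \<Longrightarrow> 1 - e / (2 * M) < fs_mass (\<mu> n) (Some ` A)"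
      using e \<open>M > 0\<close> by (auto simp: eventually_sequentially)
    have "\<bar>fs_integral (\<nu> n) f\<bar> < e" if "n \<ge> N" for n
    proof -
      let ?S = "supp (\<mu> n)" and ?B = "Some ` A"
      let ?g = "\<lambda>x. ?m n x * \<bar>f None - f x\<bar>"
      have split: "sum g ?S = sum g (?S \<inter> ?B) + sum g (?S - ?B)" for g :: "nat option \<Rightarrow> real"
        by (rule sum.Int_Diff) simp
      have "sum ?g (?S \<inter> ?B) \<le> (\<Sum>x\<in>?S \<inter> ?B. ?m n x * e)"
        by (intro sum_mono mult_left_mono nonneg) (auto simp: A_def)
      also have "\<dots> \<le> (\<Sum>x\<in>?S. ?m n x * e)"
        using e by (intro sum_mono2) (auto simp: nonneg)
      also have "\<dots> = e" by (simp add: sum_distrib_right[symmetric] total)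
      finally have near: "sum ?g (?S \<inter> ?B) \<le> e" .
      have "\<bar>f None - f x\<bar> \<le> 2 * M" for x using M[of None] M[of x] by linarith
      then have "sum ?g (?S - ?B) \<le> (\<Sum>x\<in>?S - ?B. ?m n x * (2 * M))"
        by (intro sum_mono mult_left_mono nonneg)
      also have "\<dots> = (1 - fs_mass (\<mu> n) ?B) * (2 * M)"
        using split[of "?m n"] total[of n] by (simp add: sum_distrib_right[symmetric] fs_mass_def)
      also have "\<dots> < e"
        using N[OF that] \<open>M > 0\<close> by (simp add: field_simps)
      finally have "sum ?g ?S < 2 * e" using near split[of ?g] by linarith
      moreover have "\<bar>\<Sum>x\<in>?S. ?m n x * (f None - f x)\<bar> \<le> sum ?g ?S"
        using sum_abs[of "\<lambda>x. ?m n x * (f None - f x)" ?S] by (simp add: abs_mult nonneg)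
      ultimately show ?thesis by (simp add: integral)
    qed
    then show "\<exists>N. \<forall>n\<ge>N. norm (fs_integral (\<nu> n) f - 0) < e" by auto
  qed
  with norm show ?thesis
    unfolding BJNP_def by (intro exI[of _ \<nu>]) (auto simp: fs_measure_on_def)
qed

theorem theorem1p2:
  fixes F :: "nat filter"
  assumes "free_filter F"
  shows
    "(BJNP (NF F) \<longleftrightarrow>
       (\<exists>\<mu> :: nat \<Rightarrow> nat option fs_measure.
          (\<forall>n. fs_prob_measure_on (NF F) (\<mu> n)) \<and>
          (\<forall>n. supp (\<mu> n) \<subseteq> range Some) \<and>
          (\<forall>A \<in> filter_sets F. (\<lambda>n. fs_mass (\<mu> n) (Some ` A)) \<longlonglongrightarrow> 1)))
     \<and>
     (BJNP (NF F) \<longleftrightarrow>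
       (\<exists>\<mu> :: nat \<Rightarrow> nat option fs_measure.
          (\<forall>n. fs_prob_measure_on (NF F) (\<mu> n)) \<and>
          (\<forall>n. supp (\<mu> n) \<subseteq> range Some) \<and>
          (\<forall>A \<in> filter_sets F. (\<lambda>n. fs_mass (\<mu> n) (Some ` A)) \<longlonglongrightarrow> 1) \<and>
          disjointly_supported \<mu>))"
  (is "(?J \<longleftrightarrow> ?P) \<and> (?J \<longleftrightarrow> ?D)")
proof -
  \<comment> \<open>Both equivalences follow from the cycle \<open>?J\<close>, \<open>?D\<close>,
    \<open>?P\<close>, \<open>?J\<close>.\<close>
  have "?J \<Longrightarrow> ?D" using BJNP_NF_imp_disjoint_prob[OF assms] by metis
  moreover have "?D \<Longrightarrow> ?P" by blast
  moreover have "?P \<Longrightarrow> ?J" using prob_imp_BJNP_NF by blast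
  ultimately show ?thesis by blast
qed

end
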